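(* Let $r$ be a positive integer, and let $G$ be a $K_{r+1}$-free graph. Let $X,Y$ be random variables taking values in $V(G)$ such that $\{X,Y\}$ is always an edge of $G$, and assume that $X,Y$ are symmetric, i.e. $(X,Y)$ and $(Y,X)$ have the same distribution. Then $$\mathbb{H}(X,Y)\leq 2\,\mathbb{H}(X)+\log_2\left(1-\frac1r\right).$$
   Context: Graphs are finite and simple; $K_{r+1}$ is the complete graph on $r+1$ vertices, and $G$ is $K_{r+1}$-free if it has no subgraph isomorphic to $K_{r+1}$. For a discrete random variable $X$ with finite support, $\mathbb{H}(X)=\sum_{x\in\mathrm{supp}(X)}-\mathbb{P}(X=x)\log_2\mathbb{P}(X=x)$ is its Shannon entropy, and $\mathbb{H}(X,Y)$ is the entropy of the random pair $(X,Y)$. *)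

theory Defs
  imports "HOL-Probability.Probability" "Graph_Theory.Kuratowski"
begin

text \<open>
  Finite simple graphs are the locale \<open>graph\<close> of \<open>Graph_Theory\<close>: finite, loop-free symmetric
  digraphs without parallel arcs. An undirected edge \<open>{u, v}\<close> is the pair of arcs between \<open>u\<close> and
  \<open>v\<close>, so \<open>{u, v}\<close> is an edge iff \<open>u \<rightarrow>\<^bsub>G\<^esub> v\<close>. A \<open>subgraph\<close> need not be induced, and
  \<open>K\<^bsub>n\<^esub> H\<close> says that \<open>H\<close> is a complete graph on \<open>n\<close> vertices, i.e. isomorphic to \<open>K\<^sub>n\<close>.
\<close>

definition complete_free :: "nat \<Rightarrow> ('a, 'b) pre_digraph \<Rightarrow> bool" where
  "complete_free n G \<longleftrightarrow> \<not> (\<exists>H. subgraph H G \<and> K\<^bsub>n\<^esub> H)"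

text \<open>
  The library's differential entropy, taken to base 2 and relative to the counting measure on the
  range of \<open>X\<close>. The lemma below shows that it is the sum \<open>- P(X = x) log\<^sub>2 P(X = x)\<close> over the support
  when \<open>X\<close> has finite range.
\<close>

definition shannon_entropy :: "'w measure \<Rightarrow> ('w \<Rightarrow> 'a) \<Rightarrow> real" where
  "shannon_entropy M X = prob_space.entropy M 2 (count_space (X ` space M)) X"

lemma (in prob_space) shannon_entropy_eq_sum:
  assumes "simple_function M X"
  shows "shannon_entropy M X =
    (\<Sum>x | prob {\<omega> \<in> space M. X \<omega> = x} > 0.
      - prob {\<omega> \<in> space M. X \<omega> = x} * log 2 (prob {\<omega> \<in> space M. X \<omega> = x}))"
proof -
  interpret information_space M 2 by unfold_locales simp
  let ?p = "\<lambda>x. prob {\<omega> \<in> space M. X \<omega> = x}"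
  have fin: "finite (X ` space M)" using assms by (rule simple_functionD)
  have eq: "X -` {x} \<inter> space M = {\<omega> \<in> space M. X \<omega> = x}" for x by auto
  have "simple_distributed M X ?p"
    by (rule simple_distributedI[OF assms]) (auto simp: eq)
  then have "shannon_entropy M X = - (\<Sum>x\<in>X ` space M. ?p x * log 2 (?p x))"
    unfolding shannon_entropy_def by (rule entropy_simple_distributed)
  also have "\<dots> = (\<Sum>x\<in>X ` space M. - ?p x * log 2 (?p x))" by (simp add: sum_negf)
  also have "\<dots> = (\<Sum>x | ?p x > 0. - ?p x * log 2 (?p x))"
  proof (rule sum.mono_neutral_right[OF fin])
    show "{x. ?p x > 0} \<subseteq> X ` space M"
    proof
      fix x assume "x \<in> {x. ?p x > 0}"
      then have "{\<omega> \<in> space M. X \<omega> = x} \<noteq> {}" by (metis (lifting) less_irrefl measure_empty mem_Collect_eq)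
      then show "x \<in> X ` space M" by auto
    qed
    show "\<forall>x\<in>X ` space M - {x. ?p x > 0}. - ?p x * log 2 (?p x) = 0"
      by (auto simp: zero_less_measure_iff)
  qed
  finally show ?thesis .
qed

end

theory Submission
  imports Defs
begin

text \<open>
  Write \<open>p\<close> for the distribution of \<open>X\<close> and \<open>q\<close> for that of \<open>(X, Y)\<close>. By symmetry both marginals of
  \<open>q\<close> are \<open>p\<close>, so
  \<open>H(X, Y) - 2 H(X) = (\<Sum> q(x, y) log (p(x) p(y) / q(x, y))) \<le> log (\<Sum> p(x) p(y))\<close>,
  with logarithms to base 2 and both sums over the support of \<open>q\<close>. The inequality is Jensen's for the
  concave logarithm (\<open>symmetric_joint_entropy_le\<close>). The last sum is the probability that two
  independent copies of \<open>X\<close> land in the support of \<open>q\<close>.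

  As \<open>q\<close> lives on the arcs of \<open>G\<close>, this probability is at most the quadratic form
  \<open>\<Sum> p(x) p(y)\<close> over all arcs, and the Motzkin--Straus inequality bounds this form by \<open>1 - 1/r\<close> on
  probability vectors when no clique has more than \<open>r\<close> vertices (\<open>motzkin_straus\<close>). That inequality
  holds because the form is linear along the direction that moves weight between two non-adjacent
  vertices: one of the two can be emptied without decreasing the form, until the weight sits on a
  clique, where Cauchy--Schwarz applies.
\<close>

section \<open>The Motzkin--Straus inequality\<close>

text \<open>The sum runs over ordered pairs, so for symmetric \<open>E\<close> each edge contributes twice.\<close>

definition edge_form :: "'a rel \<Rightarrow> ('a \<Rightarrow> real) \<Rightarrow> 'a set \<Rightarrow> real" where
  "edge_form E w S = (\<Sum>x\<in>S. \<Sum>y\<in>S. of_bool ((x, y) \<in> E) * (w x * w y))"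

definition nbr_weight :: "'a rel \<Rightarrow> ('a \<Rightarrow> real) \<Rightarrow> 'a set \<Rightarrow> 'a \<Rightarrow> real" where
  "nbr_weight E w S v = (\<Sum>y\<in>S. of_bool ((v, y) \<in> E) * w y)"

lemma edge_form_insert:
  assumes "finite S" "v \<notin> S" "sym E" "(v, v) \<notin> E"
  shows "edge_form E w (insert v S) = edge_form E w S + 2 * w v * nbr_weight E w S v"
proof -
  have sym: "(x, v) \<in> E \<longleftrightarrow> (v, x) \<in> E" for x
    using assms(3) by (meson symE)
  have "edge_form E w (insert v S) = edge_form E w S
      + (\<Sum>y\<in>S. of_bool ((v, y) \<in> E) * (w v * w y)) + (\<Sum>x\<in>S. of_bool ((x, v) \<in> E) * (w x * w v))"
    using assms(1,2,4) by (simp add: edge_form_def sum.distrib del: sum_of_bool_mult_eq)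
  also have "(\<Sum>y\<in>S. of_bool ((v, y) \<in> E) * (w v * w y)) = w v * nbr_weight E w S v"
    unfolding nbr_weight_def sum_distrib_left by (simp add: mult_ac)
  also have "(\<Sum>x\<in>S. of_bool ((x, v) \<in> E) * (w x * w v)) = w v * nbr_weight E w S v"
    unfolding nbr_weight_def sum_distrib_left by (simp add: mult_ac sym)
  finally show ?thesis by simp
qed

lemma edge_form_cong:
  assumes "\<And>x. x \<in> S \<Longrightarrow> w x = w' x"
  shows "edge_form E w S = edge_form E w' S"
  using assms by (simp add: edge_form_def)

lemma nbr_weight_cong:
  assumes "\<And>x. x \<in> S \<Longrightarrow> w x = w' x"
  shows "nbr_weight E w S v = nbr_weight E w' S v"
  using assms by (simp add: nbr_weight_def)

lemma edge_form_clique: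
  assumes "finite S" "irrefl E" "\<And>x y. x \<in> S \<Longrightarrow> y \<in> S \<Longrightarrow> x \<noteq> y \<Longrightarrow> (x, y) \<in> E"
  shows "edge_form E w S = (\<Sum>x\<in>S. w x)\<^sup>2 - (\<Sum>x\<in>S. (w x)\<^sup>2)"
proof -
  have "(\<Sum>y\<in>S. of_bool ((x, y) \<in> E) * (w x * w y)) = (\<Sum>y\<in>S. w x * w y) - (w x)\<^sup>2"
    if "x \<in> S" for x
  proof -
    have "(\<Sum>y\<in>S. of_bool ((x, y) \<in> E) * (w x * w y)) = (\<Sum>y\<in>S. w x * w y - (if y = x then (w x)\<^sup>2 else 0))"
      using assms that by (intro sum.cong) (auto simp: irrefl_def power2_eq_square)
    also have "\<dots> = (\<Sum>y\<in>S. w x * w y) - (w x)\<^sup>2"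
      using assms(1) that by (simp add: sum_subtractf)
    finally show ?thesis .
  qed
  then have "edge_form E w S = (\<Sum>x\<in>S. \<Sum>y\<in>S. w x * w y) - (\<Sum>x\<in>S. (w x)\<^sup>2)"
    by (simp add: edge_form_def sum_subtractf)
  then show ?thesis by (simp add: power2_eq_square sum_product)
qed

text \<open>
  Since \<open>u\<close> and \<open>v\<close> are not adjacent, the form contains no term \<open>w u * w v\<close>; their contribution is
  \<open>2 * (w u * A u + w v * A v)\<close>, where \<open>A\<close> is the weight of the neighbours in \<open>T\<close>. Hence moving all the
  weight to the vertex with the larger \<open>A\<close> cannot decrease it.
\<close>

lemma edge_form_shift_le:
  assumes "finite T" "u \<notin> T" "v \<notin> T" "u \<noteq> v" "sym E" "irrefl E" "(u, v) \<notin> E" "w u \<ge> 0"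
    and "nbr_weight E w T u \<le> nbr_weight E w T v"
  shows "edge_form E w (insert u (insert v T)) \<le> edge_form E (w(v := w u + w v)) (insert v T)"
proof -
  let ?w' = "w(v := w u + w v)"
  have loops: "(x, x) \<notin> E" for x using assms(6) by (simp add: irrefl_def)
  have "nbr_weight E w (insert v T) u = nbr_weight E w T u"
    using assms by (simp add: nbr_weight_def)
  then have "edge_form E w (insert u (insert v T))
      = edge_form E w T + 2 * w v * nbr_weight E w T v + 2 * w u * nbr_weight E w T u"
    using assms loops by (simp add: edge_form_insert)
  also have "\<dots> \<le> edge_form E w T + 2 * w v * nbr_weight E w T v + 2 * w u * nbr_weight E w T v"
    using assms(8,9) by (simp add: mult_left_mono)
  also have "\<dots> = edge_form E w T + 2 * (w u + w v) * nbr_weight E w T v"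
    by (simp add: algebra_simps)
  also have "\<dots> = edge_form E ?w' T + 2 * ?w' v * nbr_weight E ?w' T v"
    proof -
    have "w x = ?w' x" if "x \<in> T" for x using that assms(3) by auto
    then show ?thesis
      using edge_form_cong[of T w ?w' E] nbr_weight_cong[of T w ?w' E v] by simp
  qed
  also have "\<dots> = edge_form E ?w' (insert v T)"
    using assms loops by (simp add: edge_form_insert)
  finally show ?thesis .
qed

text \<open>
  The homogeneous version, for weights of arbitrary total, in which the weight shift removes a vertex
  from \<open>S\<close> and so drives an induction on the size of \<open>S\<close>. On a clique the form is
  \<open>(\<Sum> w)\<^sup>2 - \<Sum> w\<^sup>2\<close>, and Cauchy--Schwarz gives \<open>(\<Sum> w)\<^sup>2 \<le> card S * \<Sum> w\<^sup>2\<close>.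
\<close>

theorem motzkin_straus:
  assumes "finite S" "sym E" "irrefl E" "\<And>x. x \<in> S \<Longrightarrow> w x \<ge> 0"
    and "\<And>C. C \<subseteq> S \<Longrightarrow> (\<And>x y. x \<in> C \<Longrightarrow> y \<in> C \<Longrightarrow> x \<noteq> y \<Longrightarrow> (x, y) \<in> E) \<Longrightarrow> card C \<le> r"
  shows "edge_form E w S \<le> (1 - 1 / real r) * (\<Sum>x\<in>S. w x)\<^sup>2"
  using assms(1,4,5)
proof (induction "card S" arbitrary: S w rule: less_induct)
  case less
  show ?case
  proof (cases "\<forall>x\<in>S. \<forall>y\<in>S. x \<noteq> y \<longrightarrow> (x, y) \<in> E")
    case clique: True
    then have card: "card S \<le> r" using less.prems(3)[of S] by auto
    have "(\<Sum>x\<in>S. w x)\<^sup>2 \<le> (\<Sum>x\<in>S. (w x)\<^sup>2) * card S"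
      by (rule sum_squared_le_sum_of_squares)
    also have "\<dots> \<le> (\<Sum>x\<in>S. (w x)\<^sup>2) * r"
      using card by (intro mult_left_mono) (auto intro: sum_nonneg)
    finally have "(\<Sum>x\<in>S. w x)\<^sup>2 / r \<le> (\<Sum>x\<in>S. (w x)\<^sup>2)"
      by (cases "r = 0") (auto simp: divide_simps sum_nonneg)
    then show ?thesis
      using edge_form_clique[OF less.prems(1) assms(3), of w] clique by (simp add: algebra_simps)
  next
    case False
    then obtain a b where ab: "a \<in> S" "b \<in> S" "a \<noteq> b" "(a, b) \<notin> E" by blast
    have "\<exists>u v. u \<in> S \<and> v \<in> S \<and> u \<noteq> v \<and> (u, v) \<notin> E
        \<and> nbr_weight E w (S - {u, v}) u \<le> nbr_weight E w (S - {u, v}) v"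
    proof (cases "nbr_weight E w (S - {a, b}) a \<le> nbr_weight E w (S - {a, b}) b")
      case True
      then show ?thesis using ab by blast
    next
      case False
      moreover have "(b, a) \<notin> E" using ab(4) assms(2) by (meson symE)
      ultimately show ?thesis using ab
        by (intro exI[of _ b] exI[of _ a]) (auto simp: insert_commute)
    qed
    then obtain u v where uv: "u \<in> S" "v \<in> S" "u \<noteq> v" "(u, v) \<notin> E"
      "nbr_weight E w (S - {u, v}) u \<le> nbr_weight E w (S - {u, v}) v" by blast
    define T where "T = S - {u, v}"
    have S: "S = insert u (insert v T)" and T: "u \<notin> T" "v \<notin> T" "finite T"
      using uv less.prems(1) by (auto simp: T_def)
    let ?w' = "w(v := w u + w v)"
    have "edge_form E w S \<le> edge_form E ?w' (insert v T)"
      unfolding S using edge_form_shift_le[of T u v E w] T uv assms(2,3) less.prems(2)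
      by (simp add: T_def)
    also have "\<dots> \<le> (1 - 1 / real r) * (\<Sum>x\<in>insert v T. ?w' x)\<^sup>2"
    proof (rule less.hyps)
      show "card (insert v T) < card S" using T uv(3) by (simp add: S)
      show "card C \<le> r" if "C \<subseteq> insert v T"
        "\<And>x y. x \<in> C \<Longrightarrow> y \<in> C \<Longrightarrow> x \<noteq> y \<Longrightarrow> (x, y) \<in> E" for C
        using less.prems(3)[of C] that S by blast
    qed (use T uv(1,2) less.prems(2) S in auto)
    also have "(\<Sum>x\<in>insert v T. ?w' x) = w u + w v + (\<Sum>x\<in>T. ?w' x)"
      using T by simp
    also have "(\<Sum>x\<in>T. ?w' x) = (\<Sum>x\<in>T. w x)"
      using T by (intro sum.cong) auto
    also have "w u + w v + (\<Sum>x\<in>T. w x) = (\<Sum>x\<in>S. w x)"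
      using T uv(3) by (simp add: S)
    finally show ?thesis .
  qed
qed

section \<open>Cliques in graphs without complete subgraphs\<close>

lemma (in graph) complete_digraph_induced_clique:
  assumes "C \<subseteq> verts G" "\<And>x y. x \<in> C \<Longrightarrow> y \<in> C \<Longrightarrow> x \<noteq> y \<Longrightarrow> x \<rightarrow>\<^bsub>G\<^esub> y"
  shows "K\<^bsub>card C\<^esub> (G \<restriction> C)"
proof -
  have ends: "arcs_ends (G \<restriction> C) = {(u, v). (u, v) \<in> C \<times> C \<and> u \<noteq> v}"
  proof (intro set_eqI iffI)
    fix z assume "z \<in> arcs_ends (G \<restriction> C)"
    then show "z \<in> {(u, v). (u, v) \<in> C \<times> C \<and> u \<noteq> v}"
      using no_loops by (auto simp: arcs_ends_def arc_to_ends_def)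
  next
    fix z assume "z \<in> {(u, v). (u, v) \<in> C \<times> C \<and> u \<noteq> v}"
    then obtain u v where z: "z = (u, v)" "u \<in> C" "v \<in> C" "u \<noteq> v" by auto
    with assms(2) obtain e where "e \<in> arcs G" "tail G e = u" "head G e = v" by blast
    with z show "z \<in> arcs_ends (G \<restriction> C)"
      by (auto simp: arcs_ends_def arc_to_ends_def intro!: image_eqI[of _ _ e])
  qed
  have "graph (G \<restriction> C)"
  proof
    show "finite (verts (G \<restriction> C))" using finite_subset[OF assms(1) finite_verts] by simp
    show "symmetric (G \<restriction> C)" unfolding symmetric_def ends by (auto intro: symI)
  qed (auto simp: no_loops no_multi_arcs)
  then show ?thesis by (simp add: complete_digraph_def ends)
qed

lemma (in graph) clique_card_le:
  assumes "complete_free (r + 1) G" "C \<subseteq> verts G"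
    and clique: "\<And>x y. x \<in> C \<Longrightarrow> y \<in> C \<Longrightarrow> x \<noteq> y \<Longrightarrow> x \<rightarrow>\<^bsub>G\<^esub> y"
  shows "card C \<le> r"
proof (rule ccontr)
  assume "\<not> card C \<le> r"
  then obtain D where D: "D \<subseteq> C" "card D = r + 1"
    by (metis Suc_eq_plus1 not_less_eq_eq obtain_subset_with_card_n)
  have "subgraph (G \<restriction> D) G"
    using D assms(2) by (intro subgraph_induce_subgraphI) auto
  moreover have "K\<^bsub>r + 1\<^esub> (G \<restriction> D)"
    using complete_digraph_induced_clique[of D] D assms(2) clique by (metis subset_iff)
  ultimately show False using assms(1) by (auto simp: complete_free_def)
qed

section \<open>Joint entropy and the product of the marginals\<close>

text \<open>Jensen's inequality for the logarithm at the points \<open>a i / q i\<close> with weights \<open>q i\<close>.\<close>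

lemma jensen_log_ratio:
  fixes q a :: "'a \<Rightarrow> real"
  assumes "finite S" "b > 1" "(\<Sum>i\<in>S. q i) = 1" "\<And>i. i \<in> S \<Longrightarrow> q i > 0" "\<And>i. i \<in> S \<Longrightarrow> a i > 0"
  shows "(\<Sum>i\<in>S. q i * log b (a i / q i)) \<le> log b (\<Sum>i\<in>S. a i)"
proof -
  have "S \<noteq> {}" using assms(3) by auto
  then have "- log b (\<Sum>i\<in>S. q i *\<^sub>R (a i / q i)) \<le> (\<Sum>i\<in>S. q i * - log b (a i / q i))"
    using assms by (intro convex_on_sum[OF _ _ minus_log_convex]) (auto simp: less_imp_le)
  moreover have "(\<Sum>i\<in>S. q i *\<^sub>R (a i / q i)) = (\<Sum>i\<in>S. a i)"
    using assms(4) by (intro sum.cong) (auto simp: less_imp_neq[THEN not_sym])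
  ultimately show ?thesis by (simp add: sum_negf)
qed

text \<open>
  Expanding \<open>p\<close> as a marginal of \<open>q\<close> in two ways, along the first and along the second coordinate,
  puts all three entropies into one sum over the support of \<open>q\<close>, with summand
  \<open>q (x, y) * log b (p x * p y / q (x, y))\<close>. Restricting to the support matters: it is what keeps
  \<open>p x * p y\<close> from being summed over all pairs, which would only give subadditivity of entropy.
\<close>

lemma symmetric_joint_entropy_le:
  fixes q :: "'a \<times> 'a \<Rightarrow> real" and p :: "'a \<Rightarrow> real"
  assumes "finite V" "b > 1" "\<And>z. q z \<ge> 0" "\<And>x y. q (x, y) = q (y, x)"
    and p: "\<And>x. x \<in> V \<Longrightarrow> p x = (\<Sum>y\<in>V. q (x, y))" and "(\<Sum>x\<in>V. p x) = 1"
  defines "S \<equiv> {z \<in> V \<times> V. q z > 0}"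
  shows "(\<Sum>z\<in>S. - q z * log b (q z))
    \<le> 2 * (\<Sum>x\<in>V. - p x * log b (p x)) + log b (\<Sum>(x, y)\<in>S. p x * p y)"
proof -
  have fin: "finite S" using assms(1) by (simp add: S_def)
  have restrict: "(\<Sum>x\<in>V. \<Sum>y\<in>V. q (x, y) * f x y) = (\<Sum>(x, y)\<in>S. q (x, y) * f x y)" for f
    unfolding sum.cartesian_product
  proof (rule sum.mono_neutral_right)
    show "\<forall>z\<in>V \<times> V - S. (case z of (x, y) \<Rightarrow> q (x, y) * f x y) = 0"
      using assms(3) by (force simp: S_def not_less intro: antisym)
  qed (use assms(1) in \<open>auto simp: S_def\<close>)
  have total: "(\<Sum>z\<in>S. q z) = 1"
    using restrict[of "\<lambda>_ _. 1"] assms(6) p by (simp add: case_prod_unfold)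
  have fst: "(\<Sum>x\<in>V. p x * log b (p x)) = (\<Sum>(x, y)\<in>S. q (x, y) * log b (p x))"
    by (simp add: p sum_distrib_right flip: restrict)
  have "(\<Sum>x\<in>V. p x * log b (p x)) = (\<Sum>x\<in>V. \<Sum>y\<in>V. q (x, y) * log b (p x))"
    by (simp add: p sum_distrib_right)
  also have "\<dots> = (\<Sum>y\<in>V. \<Sum>x\<in>V. q (x, y) * log b (p x))" by (rule sum.swap)
  also have "\<dots> = (\<Sum>x\<in>V. \<Sum>y\<in>V. q (x, y) * log b (p y))" using assms(4) by simp
  finally have snd: "(\<Sum>x\<in>V. p x * log b (p x)) = (\<Sum>(x, y)\<in>S. q (x, y) * log b (p y))"
    by (simp add: restrict)
  have pos: "p x > 0" "p y > 0" if "(x, y) \<in> S" for x y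
  proof -
    have "x \<in> V" "y \<in> V" "q (x, y) > 0" "q (y, x) > 0" using that assms(4)[of x y] by (auto simp: S_def)
    then show "p x > 0" "p y > 0"
      using p assms(1,3) sum_pos2[of V y "\<lambda>y. q (x, y)"] sum_pos2[of V x "\<lambda>x. q (y, x)"] by auto
  qed
  have "(\<Sum>z\<in>S. - q z * log b (q z)) - 2 * (\<Sum>x\<in>V. - p x * log b (p x))
      = (\<Sum>(x, y)\<in>S. q (x, y) * (log b (p x) + log b (p y) - log b (q (x, y))))"
    using fst snd by (simp add: case_prod_unfold algebra_simps sum.distrib sum_subtractf sum_negf)
  also have "\<dots> = (\<Sum>z\<in>S. q z * log b (p (fst z) * p (snd z) / q z))"
  proof (intro sum.cong refl)
    fix z assume "z \<in> S"
    then have "p (fst z) > 0" "p (snd z) > 0" "q z > 0" using pos[of "fst z" "snd z"] by (auto simp: S_def)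
    then show "(case z of (x, y) \<Rightarrow> q (x, y) * (log b (p x) + log b (p y) - log b (q (x, y))))
        = q z * log b (p (fst z) * p (snd z) / q z)"
      by (simp add: case_prod_unfold log_divide log_mult)
  qed
  also have "\<dots> \<le> log b (\<Sum>z\<in>S. p (fst z) * p (snd z))"
    using fin total pos assms(2) by (intro jensen_log_ratio) (auto simp: S_def)
  finally show ?thesis by (simp add: case_prod_unfold)
qed

section \<open>The entropy inequality\<close>

lemma vimage_singleton_Int: "f -` {z} \<inter> A = {a \<in> A. f a = z}"
  by auto

theorem theorem1p2:
  fixes r :: nat and G :: "('v, 'e) pre_digraph"
    and M :: "'w measure" and X Y :: "'w \<Rightarrow> 'v"
  assumes "r > 0"
    and "graph G"
    and "complete_free (r + 1) G"
    and "prob_space M"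
    and "X \<in> M \<rightarrow>\<^sub>M count_space (verts G)"
    and "Y \<in> M \<rightarrow>\<^sub>M count_space (verts G)"
    and "\<And>\<omega>. \<omega> \<in> space M \<Longrightarrow> X \<omega> \<rightarrow>\<^bsub>G\<^esub> Y \<omega>"
    and "distr M (count_space (verts G \<times> verts G)) (\<lambda>\<omega>. (X \<omega>, Y \<omega>)) =
         distr M (count_space (verts G \<times> verts G)) (\<lambda>\<omega>. (Y \<omega>, X \<omega>))"
  shows "shannon_entropy M (\<lambda>\<omega>. (X \<omega>, Y \<omega>)) \<le> 2 * shannon_entropy M X + log 2 (1 - 1 / real r)"
proof -
  interpret graph G by fact
  interpret prob_space M by fact
  let ?V = "verts G"
  let ?E = "arcs_ends G"
  define p where "p x = prob {\<omega> \<in> space M. X \<omega> = x}" for x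
  define q where "q z = prob {\<omega> \<in> space M. (X \<omega>, Y \<omega>) = z}" for z
  define S where "S = {z \<in> ?V \<times> ?V. q z > 0}"
  have XV: "X \<omega> \<in> ?V" and YV: "Y \<omega> \<in> ?V" if "\<omega> \<in> space M" for \<omega>
    using measurable_space[OF assms(5) that] measurable_space[OF assms(6) that] by auto
  have setsX: "{\<omega> \<in> space M. X \<omega> = x} \<in> sets M" and setsY: "{\<omega> \<in> space M. Y \<omega> = x} \<in> sets M" for x
  proof -
    have "{\<omega> \<in> space M. X \<omega> = x} = X -` ({x} \<inter> ?V) \<inter> space M" using XV by auto
    then show "{\<omega> \<in> space M. X \<omega> = x} \<in> sets M" by (simp only:) (rule measurable_sets[OF assms(5)], simp)
    have "{\<omega> \<in> space M. Y \<omega> = x} = Y -` ({x} \<inter> ?V) \<inter> space M" using YV by auto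
    then show "{\<omega> \<in> space M. Y \<omega> = x} \<in> sets M" by (simp only:) (rule measurable_sets[OF assms(6)], simp)
  qed
  have setsXY: "{\<omega> \<in> space M. (X \<omega>, Y \<omega>) = z} \<in> sets M" for z
  proof -
    have "{\<omega> \<in> space M. (X \<omega>, Y \<omega>) = z} = {\<omega> \<in> space M. X \<omega> = fst z} \<inter> {\<omega> \<in> space M. Y \<omega> = snd z}"
      by auto
    then show ?thesis using setsX setsY by auto
  qed
  have setsYX: "{\<omega> \<in> space M. (Y \<omega>, X \<omega>) = z} \<in> sets M" for z
    using setsXY[of "(snd z, fst z)"] by (rule back_subst[of "\<lambda>A. A \<in> sets M"]) auto
  have simpleX: "simple_function M X"
    unfolding simple_function_def
  proof
    show "finite (X ` space M)" by (rule finite_subset[OF _ finite_verts]) (use XV in auto)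
    show "\<forall>x\<in>X ` space M. X -` {x} \<inter> space M \<in> sets M"
      using setsX by (simp add: vimage_singleton_Int)
  qed
  have simpleXY: "simple_function M (\<lambda>\<omega>. (X \<omega>, Y \<omega>))"
    unfolding simple_function_def
  proof
    show "finite ((\<lambda>\<omega>. (X \<omega>, Y \<omega>)) ` space M)"
      by (rule finite_subset[of _ "?V \<times> ?V"]) (use XV YV in auto)
    show "\<forall>z\<in>(\<lambda>\<omega>. (X \<omega>, Y \<omega>)) ` space M. (\<lambda>\<omega>. (X \<omega>, Y \<omega>)) -` {z} \<inter> space M \<in> sets M"
      using setsXY by (simp add: vimage_singleton_Int del: prod.inject)
  qed
  have pV: "x \<in> ?V" if "p x > 0" for x
  proof -
    have "{\<omega> \<in> space M. X \<omega> = x} \<noteq> {}" using that by (metis p_def less_irrefl measure_empty)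
    then show ?thesis using XV by auto
  qed
  have qE: "z \<in> ?E \<and> z \<in> ?V \<times> ?V" if "q z > 0" for z
  proof -
    have "{\<omega> \<in> space M. (X \<omega>, Y \<omega>) = z} \<noteq> {}" using that by (metis q_def less_irrefl measure_empty)
    then show ?thesis using assms(7) XV YV by auto
  qed
  have HX: "shannon_entropy M X = (\<Sum>x\<in>?V. - p x * log 2 (p x))"
  proof -
    have "shannon_entropy M X = (\<Sum>x | p x > 0. - p x * log 2 (p x))"
      unfolding p_def by (rule shannon_entropy_eq_sum[OF simpleX])
    also have "\<dots> = (\<Sum>x\<in>?V. - p x * log 2 (p x))"
      using pV by (intro sum.mono_neutral_left) (auto simp: p_def zero_less_measure_iff)
    finally show ?thesis .
  qed
  have "{z. q z > 0} = S" using qE by (auto simp: S_def)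
  then have HXY: "shannon_entropy M (\<lambda>\<omega>. (X \<omega>, Y \<omega>)) = (\<Sum>z\<in>S. - q z * log 2 (q z))"
    using shannon_entropy_eq_sum[OF simpleXY] unfolding q_def by simp
  have p_sum: "(\<Sum>x\<in>?V. p x) = 1"
  proof -
    have "(\<Sum>x\<in>?V. p x) = prob (\<Union>x\<in>?V. {\<omega> \<in> space M. X \<omega> = x})"
      unfolding p_def
      by (rule finite_measure_finite_Union[symmetric]) (use setsX in \<open>auto simp: disjoint_family_on_def\<close>)
    also have "(\<Union>x\<in>?V. {\<omega> \<in> space M. X \<omega> = x}) = space M" using XV by auto
    finally show ?thesis by (simp add: prob_space)
  qed
  have p_marginal: "p x = (\<Sum>y\<in>?V. q (x, y))" for x
  proof -
    have "(\<Sum>y\<in>?V. q (x, y)) = prob (\<Union>y\<in>?V. {\<omega> \<in> space M. (X \<omega>, Y \<omega>) = (x, y)})"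
      unfolding q_def
      by (rule finite_measure_finite_Union[symmetric]) (use setsXY in \<open>auto simp: disjoint_family_on_def\<close>)
    also have "(\<Union>y\<in>?V. {\<omega> \<in> space M. (X \<omega>, Y \<omega>) = (x, y)}) = {\<omega> \<in> space M. X \<omega> = x}"
      using YV by auto
    finally show ?thesis by (simp add: p_def)
  qed
  have q_sym: "q (x, y) = q (y, x)" for x y
  proof (cases "x \<in> ?V \<and> y \<in> ?V")
    case True
    let ?C = "count_space (?V \<times> ?V)"
    have meas: "(\<lambda>\<omega>. (X \<omega>, Y \<omega>)) \<in> M \<rightarrow>\<^sub>M ?C" "(\<lambda>\<omega>. (Y \<omega>, X \<omega>)) \<in> M \<rightarrow>\<^sub>M ?C"
      using XV YV setsXY setsYX by (auto simp: measurable_count_space_eq2 vimage_singleton_Int simp del: prod.inject)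
    have "q (x, y) = measure (distr M ?C (\<lambda>\<omega>. (X \<omega>, Y \<omega>))) {(x, y)}"
      using True by (simp add: q_def measure_distr[OF meas(1)] vimage_singleton_Int)
    also have "\<dots> = measure (distr M ?C (\<lambda>\<omega>. (Y \<omega>, X \<omega>))) {(x, y)}" using assms(8) by simp
    also have "\<dots> = q (y, x)"
      using True by (simp add: q_def measure_distr[OF meas(2)] vimage_singleton_Int conj_commute)
    finally show ?thesis .
  next
    case False
    then have "{\<omega> \<in> space M. (X \<omega>, Y \<omega>) = (x, y)} = {}" "{\<omega> \<in> space M. (X \<omega>, Y \<omega>) = (y, x)} = {}"
      using XV YV by auto
    then show ?thesis by (simp only: q_def)
  qed
  let ?s = "\<Sum>(x, y)\<in>S. p x * p y"
  have "?s \<le> edge_form ?E p ?V"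
  proof -
    have "?s = (\<Sum>(x, y)\<in>S. of_bool ((x, y) \<in> ?E) * (p x * p y))"
      using qE by (intro sum.cong) (auto simp: S_def)
    also have "\<dots> \<le> (\<Sum>(x, y)\<in>?V \<times> ?V. of_bool ((x, y) \<in> ?E) * (p x * p y))"
      by (intro sum_mono2) (auto simp: S_def p_def)
    finally show ?thesis unfolding edge_form_def sum.cartesian_product .
  qed
  also have "\<dots> \<le> (1 - 1 / real r) * (\<Sum>x\<in>?V. p x)\<^sup>2"
  proof (rule motzkin_straus)
    show "sym ?E" using sym_arcs by (simp add: symmetric_def)
    show "irrefl ?E" using no_loops by (auto simp: irrefl_def arcs_ends_def arc_to_ends_def)
  qed (use clique_card_le[OF assms(3)] in \<open>auto simp: p_def\<close>)
  finally have bound: "?s \<le> 1 - 1 / real r" by (simp add: p_sum)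
  \<comment> \<open>Monotonicity of the logarithm needs a positive argument; this also excludes \<open>r = 1\<close>, where the
    bound \<open>1 - 1 / r\<close> vanishes.\<close>
  have "?s > 0"
  proof (rule sum_pos)
    show "finite S" by (simp add: S_def)
    show "S \<noteq> {}"
    proof
      assume "S = {}"
      then have "q (x, y) = 0" if "x \<in> ?V" "y \<in> ?V" for x y
        using that by (auto simp: S_def q_def zero_less_measure_iff)
      then show False using p_sum by (simp add: p_marginal)
    qed
    show "(case z of (x, y) \<Rightarrow> p x * p y) > 0" if "z \<in> S" for z
    proof -
      obtain x y where z: "z = (x, y)" by fastforce
      then have "q (x, y) > 0" "q (y, x) > 0" using that q_sym[of x y] by (auto simp: S_def)
      moreover have "q (u, v) \<le> p u" for u v
        unfolding p_def q_def using setsX by (intro finite_measure_mono) auto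
      ultimately have "p x > 0" "p y > 0" by (meson less_le_trans)+
      then show ?thesis by (simp add: z)
    qed
  qed
  then have "log 2 ?s \<le> log 2 (1 - 1 / real r)" using bound by simp
  moreover have "(\<Sum>z\<in>S. - q z * log 2 (q z)) \<le> 2 * (\<Sum>x\<in>?V. - p x * log 2 (p x)) + log 2 ?s"
    unfolding S_def
  proof (rule symmetric_joint_entropy_le[where q = q])
    show "q z \<ge> 0" for z by (simp add: q_def)
    show "q (x, y) = q (y, x)" for x y by (rule q_sym)
    show "p x = (\<Sum>y\<in>?V. q (x, y))" for x by (rule p_marginal)
    show "(\<Sum>x\<in>?V. p x) = 1" by (rule p_sum)
  qed simp_all
  ultimately show ?thesis unfolding HX HXY by simp
qed

end
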